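(* Let $Y=Y_1+\dots+Y_n$, where $Y_1,\dots,Y_n$ are independent zero-mean random variables with finite variances such that, for some real $b>0$, $Y_i\le b$ for all $i\in\{1,\dots,n\}$. Let $\sigma_i^2:=\operatorname{Var}Y_i=\mathsf{E}Y_i^2$ and $\sigma^2:=\sigma_1^2+\dots+\sigma_n^2$, and assume $\sigma^2>0$. Then for all real $y>0$, $$\mathsf{P}(Y\ge y)\le\min\Big(1,\frac{\mu-1}{v-1-\ln v}\Big),$$ where $$\mu:=\exp\Big\{\frac yb\Big[1-\frac{\sigma^2}{by}\,\ln\Big(1+\frac{by}{\sigma^2}\Big)\Big]\Big\}\quad\text{and}\quad v:=\exp\Big\{\frac yb\,\ln\Big(1+\frac{by}{\sigma^2}\Big)\Big\}.$$
   Context: $\mathsf{P}$, $\mathsf{E}$ and $\operatorname{Var}$ denote probability, expectation and variance. *)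

theory Defs
  imports "HOL-Probability.Probability"
begin

end

theory Submission
  imports Defs
begin

text \<open>
  With \<open>\<lambda> = ln (1 + b y / s) / b\<close>, Bennett's bound on the moment generating function gives
  \<open>E (exp (\<lambda> Y)) \<le> \<mu>\<close>, and \<open>v = exp (\<lambda> y)\<close>. Instead of \<open>exp (\<lambda> Y)\<close>, apply Markov's inequality to
  \<open>exp (\<lambda> Y) - 1 - \<lambda> Y\<close>, which is nonnegative, is at least \<open>v - 1 - ln v\<close> on the event \<open>Y \<ge> y\<close>,
  and has expectation at most \<open>\<mu> - 1\<close> because \<open>E Y = 0\<close>.
\<close>

text \<open>The right side minus the left has derivative \<open>1 + t - exp t \<le> 0\<close> and
  vanishes at 0, so it is nonnegative to the left of 0.\<close>

lemma exp_le_quadratic_of_nonpos: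
  fixes x :: real
  assumes "x \<le> 0"
  shows "exp x \<le> 1 + x + x\<^sup>2 / 2"
proof -
  have "1 + x + x\<^sup>2 / 2 - exp x \<ge> 1 + 0 + 0\<^sup>2 / 2 - exp (0 :: real)"
  proof (rule DERIV_nonpos_imp_nonincreasing[OF assms])
    fix t :: real
    have "((\<lambda>x. 1 + x + x\<^sup>2 / 2 - exp x) has_real_derivative 1 + t - exp t) (at t)"
      by (auto intro!: derivative_eq_intros)
    moreover have "1 + t - exp t \<le> 0"
      using exp_ge_add_one_self[of t] by simp
    ultimately show "\<exists>d. ((\<lambda>x. 1 + x + x\<^sup>2 / 2 - exp x) has_real_derivative d) (at t) \<and> d \<le> 0"
      by blast
  qed
  then show ?thesis by simp
qed

text \<open>This is monotonicity of the ratio \<open>(exp u - 1 - u) / u\<^sup>2\<close>,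
  cross-multiplied so that \<open>u = 0\<close> needs no separate convention.\<close>

lemma exp_remainder_mono:
  fixes u c :: real
  assumes "u \<le> c" and "c > 0"
  shows "(exp u - 1 - u) * c\<^sup>2 \<le> u\<^sup>2 * (exp c - 1 - c)"
proof (cases "u \<le> 0")
  case True
  \<comment> \<open>The value 1/2, the limit of the ratio at 0, separates its values at
    \<open>u \<le> 0\<close> from those at \<open>c > 0\<close>.\<close>
  have "(exp u - 1 - u) * c\<^sup>2 \<le> (u\<^sup>2 / 2) * c\<^sup>2"
    using exp_le_quadratic_of_nonpos[OF True] by (intro mult_right_mono) auto
  also have "\<dots> = u\<^sup>2 * (c\<^sup>2 / 2)" by simp
  also have "\<dots> \<le> u\<^sup>2 * (exp c - 1 - c)"
    using exp_lower_Taylor_quadratic[of c] \<open>c > 0\<close> by (intro mult_left_mono) auto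
  finally show ?thesis .
next
  case False
  \<comment> \<open>For \<open>u > 0\<close> the power series are compared term by term. The shift
    by 2 drops the terms \<open>1 + x\<close>, and after removing common factors the claim is
    \<open>u ^ k \<le> c ^ k\<close>.\<close>
  define f where "f x k = inverse (fact (k + 2)) * x ^ (k + 2)" for x :: real and k :: nat
  have summ: "summable (f x)" for x
    unfolding f_def
    using summable_exp_generic[of x, THEN summable_ignore_initial_segment, of 2]
    by (simp add: scaleR_conv_of_real)
  have remainder: "exp x - 1 - x = suminf (f x)" for x
    unfolding f_def using exp_first_two_terms[of x] by simp
  have "f u k * c\<^sup>2 \<le> u\<^sup>2 * f c k" for k
  proof -
    have "u ^ k \<le> c ^ k" using False assms by (intro power_mono) auto
    then have "inverse (fact (k + 2)) * u\<^sup>2 * c\<^sup>2 * u ^ k \<le> inverse (fact (k + 2)) * u\<^sup>2 * c\<^sup>2 * c ^ k"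
      by (intro mult_left_mono) auto
    then show ?thesis by (simp only: f_def power_add mult_ac)
  qed
  then have "(\<Sum>k. f u k * c\<^sup>2) \<le> (\<Sum>k. u\<^sup>2 * f c k)"
    by (intro suminf_le summable_mult summable_mult2 summ)
  then show ?thesis
    by (simp add: remainder suminf_mult2[OF summ] suminf_mult[OF summ])
qed

text \<open>Monotonicity of the ratio between \<open>l * x\<close> and \<open>l * b\<close>, with
  \<open>l\<^sup>2\<close> cancelled. The bound is quadratic in \<open>x\<close>, so its expectation
  involves only the first two moments.\<close>

lemma exp_le_bennett:
  fixes x b l :: real
  assumes "x \<le> b" "b > 0" "l > 0"
  shows "exp (l * x) \<le> 1 + l * x + x\<^sup>2 * ((exp (l * b) - 1 - l * b) / b\<^sup>2)"
proof -
  have "(exp (l * x) - 1 - l * x) * (l * b)\<^sup>2 \<le> (l * x)\<^sup>2 * (exp (l * b) - 1 - l * b)"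
    using assms by (intro exp_remainder_mono) auto
  then have "l\<^sup>2 * ((exp (l * x) - 1 - l * x) * b\<^sup>2) \<le> l\<^sup>2 * (x\<^sup>2 * (exp (l * b) - 1 - l * b))"
    by (simp only: power_mult_distrib mult_ac)
  then have "(exp (l * x) - 1 - l * x) * b\<^sup>2 \<le> x\<^sup>2 * (exp (l * b) - 1 - l * b)"
    by (rule mult_left_le_imp_le) (use assms in auto)
  then have "exp (l * x) - 1 - l * x \<le> x\<^sup>2 * (exp (l * b) - 1 - l * b) / b\<^sup>2"
    using \<open>b > 0\<close> by (subst pos_le_divide_eq) auto
  then show ?thesis by simp
qed

context prob_space
begin

lemma integrable_exp_of_AE_le:
  fixes X :: "'a \<Rightarrow> real"
  assumes [measurable]: "X \<in> borel_measurable M" and "AE \<omega> in M. X \<omega> \<le> b" and "l \<ge> 0"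
  shows "integrable M (\<lambda>\<omega>. exp (l * X \<omega>))"
proof (rule integrable_const_bound)
  show "AE \<omega> in M. norm (exp (l * X \<omega>)) \<le> exp (l * b)"
    using assms(2) by eventually_elim (use \<open>l \<ge> 0\<close> in \<open>auto intro: mult_left_mono\<close>)
qed measurable

text \<open>Integrating the pointwise bound, the linear term vanishes and the second moment is the
  variance. The final passage from \<open>1 + t\<close> to \<open>exp t\<close> lets the bounds for
  several variables multiply into one exponential.\<close>

lemma expectation_exp_le_bennett:
  fixes X :: "'a \<Rightarrow> real"
  assumes int: "integrable M X" "integrable M (\<lambda>\<omega>. (X \<omega>)\<^sup>2)"
    and mean: "expectation X = 0"
    and bound: "AE \<omega> in M. X \<omega> \<le> b" and "b > 0" "l > 0"
  shows "expectation (\<lambda>\<omega>. exp (l * X \<omega>)) \<le> exp (variance X * ((exp (l * b) - 1 - l * b) / b\<^sup>2))"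
proof -
  define K where "K = (exp (l * b) - 1 - l * b) / b\<^sup>2"
  have "expectation (\<lambda>\<omega>. exp (l * X \<omega>)) \<le> expectation (\<lambda>\<omega>. 1 + l * X \<omega> + (X \<omega>)\<^sup>2 * K)"
  proof (rule integral_mono_AE)
    show "integrable M (\<lambda>\<omega>. exp (l * X \<omega>))"
      using int bound \<open>l > 0\<close> by (intro integrable_exp_of_AE_le[of X b]) auto
    show "AE \<omega> in M. exp (l * X \<omega>) \<le> 1 + l * X \<omega> + (X \<omega>)\<^sup>2 * K"
      using bound unfolding K_def
      by eventually_elim (rule exp_le_bennett[OF _ \<open>b > 0\<close> \<open>l > 0\<close>])
  qed (use int in auto)
  also have "\<dots> = 1 + variance X * K"
    using int by (simp add: mean prob_space)
  also have "\<dots> \<le> exp (variance X * K)"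
    by (rule exp_ge_add_one_self)
  finally show ?thesis unfolding K_def .
qed

text \<open>Independence turns the exponential of the sum into a product of independent factors,
  which gives integrability and factorizes the expectation.\<close>

lemma
  fixes Y :: "'i \<Rightarrow> 'a \<Rightarrow> real"
  assumes "finite I" and indep: "indep_vars (\<lambda>_. borel) Y I"
    and int: "\<And>i. i \<in> I \<Longrightarrow> integrable M (Y i)" "\<And>i. i \<in> I \<Longrightarrow> integrable M (\<lambda>\<omega>. (Y i \<omega>)\<^sup>2)"
    and mean: "\<And>i. i \<in> I \<Longrightarrow> expectation (Y i) = 0"
    and bound: "\<And>i. i \<in> I \<Longrightarrow> AE \<omega> in M. Y i \<omega> \<le> b" and "b > 0" "l > 0"
  shows integrable_exp_sum_indep: "integrable M (\<lambda>\<omega>. exp (l * (\<Sum>i\<in>I. Y i \<omega>)))"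
    and expectation_exp_sum_le_bennett:
      "expectation (\<lambda>\<omega>. exp (l * (\<Sum>i\<in>I. Y i \<omega>)))
        \<le> exp ((\<Sum>i\<in>I. variance (Y i)) * ((exp (l * b) - 1 - l * b) / b\<^sup>2))"
proof -
  have prod: "exp (l * (\<Sum>i\<in>I. Y i \<omega>)) = (\<Prod>i\<in>I. exp (l * Y i \<omega>))" for \<omega>
    using \<open>finite I\<close> by (simp add: sum_distrib_left exp_sum)
  have indep_exp: "indep_vars (\<lambda>_. borel) (\<lambda>i \<omega>. exp (l * Y i \<omega>)) I"
    by (rule indep_vars_compose2[OF indep]) auto
  have int_exp: "integrable M (\<lambda>\<omega>. exp (l * Y i \<omega>))" if "i \<in> I" for i
    using int(1)[OF that] bound[OF that] \<open>l > 0\<close> by (intro integrable_exp_of_AE_le[of _ b]) auto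
  show "integrable M (\<lambda>\<omega>. exp (l * (\<Sum>i\<in>I. Y i \<omega>)))"
    unfolding prod by (rule indep_vars_integrable[OF \<open>finite I\<close> indep_exp int_exp])
  have "expectation (\<lambda>\<omega>. exp (l * (\<Sum>i\<in>I. Y i \<omega>))) = (\<Prod>i\<in>I. expectation (\<lambda>\<omega>. exp (l * Y i \<omega>)))"
    unfolding prod by (rule indep_vars_lebesgue_integral[OF \<open>finite I\<close> indep_exp int_exp])
  also have "\<dots> \<le> (\<Prod>i\<in>I. exp (variance (Y i) * ((exp (l * b) - 1 - l * b) / b\<^sup>2)))"
    using int mean bound \<open>b > 0\<close> \<open>l > 0\<close>
    by (intro prod_mono conjI expectation_exp_le_bennett integral_nonneg_AE) auto
  also have "\<dots> = exp ((\<Sum>i\<in>I. variance (Y i)) * ((exp (l * b) - 1 - l * b) / b\<^sup>2))"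
    using \<open>finite I\<close> by (simp only: exp_sum sum_distrib_right)
  finally show "expectation (\<lambda>\<omega>. exp (l * (\<Sum>i\<in>I. Y i \<omega>)))
      \<le> exp ((\<Sum>i\<in>I. variance (Y i)) * ((exp (l * b) - 1 - l * b) / b\<^sup>2))" .
qed

lemma prob_ge_le_exp_remainder:
  fixes X :: "'a \<Rightarrow> real"
  assumes int: "integrable M X" "integrable M (\<lambda>\<omega>. exp (l * X \<omega>))"
    and mean: "expectation X = 0" and "l > 0" "y > 0"
  shows "prob {\<omega> \<in> space M. X \<omega> \<ge> y}
    \<le> (expectation (\<lambda>\<omega>. exp (l * X \<omega>)) - 1) / (exp (l * y) - 1 - l * y)"
proof -
  define g where "g t = exp (l * t) - 1 - l * t" for t
  \<comment> \<open>The quadratic Taylor bound makes \<open>g y\<close> strictly positive, as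
    Markov's inequality requires of its threshold.\<close>
  have "0 < (l * y)\<^sup>2 / 2" using assms by simp
  then have g_pos: "g y > 0"
    unfolding g_def using exp_lower_Taylor_quadratic[of "l * y"] assms(4,5)
    by (smt (verit) mult_pos_pos)
  have g_nonneg: "g t \<ge> 0" for t
    unfolding g_def using exp_ge_add_one_self[of "l * t"] by linarith
  \<comment> \<open>\<open>g\<close> decreases on the negative axis and increases on the positive
    one; \<open>y > 0\<close> keeps the whole interval where the derivative is nonnegative.\<close>
  have g_mono: "g y \<le> g t" if "y \<le> t" for t
  proof (rule DERIV_nonneg_imp_nondecreasing[OF that])
    fix x assume "y \<le> x"
    have "(g has_real_derivative l * (exp (l * x) - 1)) (at x)"
      unfolding g_def by (auto intro!: derivative_eq_intros simp: algebra_simps)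
    moreover have "l * (exp (l * x) - 1) \<ge> 0"
      using \<open>y \<le> x\<close> assms by simp
    ultimately show "\<exists>d. (g has_real_derivative d) (at x) \<and> d \<ge> 0" by blast
  qed
  have int_g: "integrable M (\<lambda>\<omega>. g (X \<omega>))"
    unfolding g_def using int by auto
  have "prob {\<omega> \<in> space M. X \<omega> \<ge> y} \<le> prob {\<omega> \<in> space M. g (X \<omega>) \<ge> g y}"
    using int_g by (intro finite_measure_mono) (auto intro: g_mono)
  also have "\<dots> \<le> expectation (\<lambda>\<omega>. g (X \<omega>)) / g y"
    by (rule integral_Markov_inequality_measure[where A = "{}", OF int_g]) (auto simp: g_nonneg g_pos)
  also have "expectation (\<lambda>\<omega>. g (X \<omega>)) = expectation (\<lambda>\<omega>. exp (l * X \<omega>)) - 1"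
    unfolding g_def using int by (simp add: mean prob_space)
  finally show ?thesis unfolding g_def .
qed

end

theorem proposition3p4:
  fixes M :: "'a measure"
    and Y :: "nat \<Rightarrow> 'a \<Rightarrow> real"
    and n :: nat
    and b s y \<mu> v :: real
  assumes "prob_space M"
    and "prob_space.indep_vars M (\<lambda>_. borel) Y {1..n}"
    and "\<And>i. i \<in> {1..n} \<Longrightarrow> integrable M (Y i)"
    and "\<And>i. i \<in> {1..n} \<Longrightarrow> prob_space.expectation M (Y i) = 0"
    and "\<And>i. i \<in> {1..n} \<Longrightarrow> integrable M (\<lambda>\<omega>. (Y i \<omega>)\<^sup>2)"
    and "b > 0"
    and "\<And>i. i \<in> {1..n} \<Longrightarrow> AE \<omega> in M. Y i \<omega> \<le> b"
    and "s = (\<Sum>i=1..n. prob_space.variance M (Y i))"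
    and "s > 0"
    and "y > 0"
    and "\<mu> = exp (y / b * (1 - s / (b * y) * ln (1 + b * y / s)))"
    and "v = exp (y / b * ln (1 + b * y / s))"
  shows "prob_space.prob M {\<omega> \<in> space M. (\<Sum>i=1..n. Y i \<omega>) \<ge> y}
           \<le> min 1 ((\<mu> - 1) / (v - 1 - ln v))"
proof -
  interpret prob_space M by fact
  \<comment> \<open>This is the minimizer of
    \<open>s * (exp (l * b) - 1 - l * b) / b\<^sup>2 - l * y\<close>, the exponent in the classical
    Bennett bound: stationarity reads \<open>exp (l * b) = 1 + b * y / s\<close>.\<close>
  define l where "l = ln (1 + b * y / s) / b"
  define S where "S \<omega> = (\<Sum>i=1..n. Y i \<omega>)" for \<omega>
  have "b * y / s > 0"
    using assms(6,9,10) by simp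
  then have "ln (1 + b * y / s) > 0"
    by (intro ln_gt_zero) linarith
  then have "l > 0"
    unfolding l_def using assms(6) by simp
  have exp_lb: "exp (l * b) = 1 + b * y / s"
    unfolding l_def using assms(6) \<open>b * y / s > 0\<close> by (simp add: add_pos_pos)
  \<comment> \<open>Hence \<open>ln v = l * y\<close>, and \<open>v - 1 - ln v\<close> is the
    denominator of the Markov bound.\<close>
  have v: "v = exp (l * y)"
    unfolding assms(12) l_def by (simp add: mult_ac)
  \<comment> \<open>At this \<open>l\<close> the exponent of the moment generating function bound
    becomes the exponent of \<open>\<mu>\<close>.\<close>
  have "s * ((exp (l * b) - 1 - l * b) / b\<^sup>2) = y / b - s * l / b"
    unfolding exp_lb using assms(6,9) by (simp add: field_simps power2_eq_square)
  also have "\<dots> = y / b * (1 - s / (b * y) * ln (1 + b * y / s))"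
    unfolding l_def using assms(6,10) by (simp add: field_simps)
  finally have \<mu>: "exp (s * ((exp (l * b) - 1 - l * b) / b\<^sup>2)) = \<mu>"
    unfolding assms(11) by simp
  have mgf: "integrable M (\<lambda>\<omega>. exp (l * S \<omega>))" "expectation (\<lambda>\<omega>. exp (l * S \<omega>)) \<le> \<mu>"
    unfolding S_def \<mu>[symmetric] assms(8)
    by (rule integrable_exp_sum_indep expectation_exp_sum_le_bennett;
        use assms(2-7) \<open>l > 0\<close> in simp)+
  have "integrable M S" "expectation S = 0"
    unfolding S_def using assms(3,4) by auto
  then have "prob {\<omega> \<in> space M. S \<omega> \<ge> y}
      \<le> (expectation (\<lambda>\<omega>. exp (l * S \<omega>)) - 1) / (exp (l * y) - 1 - l * y)"
    using mgf(1) \<open>l > 0\<close> assms(10) by (intro prob_ge_le_exp_remainder)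
  also have "\<dots> \<le> (\<mu> - 1) / (exp (l * y) - 1 - l * y)"
    using mgf(2) exp_ge_add_one_self[of "l * y"] by (intro divide_right_mono) linarith+
  finally have "prob {\<omega> \<in> space M. S \<omega> \<ge> y} \<le> (\<mu> - 1) / (v - 1 - ln v)"
    by (simp add: v)
  then show ?thesis
    unfolding S_def by simp
qed

end
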